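(* Let $\lambda$ be a regular cardinal and $\mathcal A$ a $\lambda$-mono-generated category. Let $\mathcal D$ be a $\lambda$-directed diagram (indexing poset) and $F_1,F_2:\mathcal D\to\mathcal A$ two functors sending all maps to $\lambda$-embeddings, such that $\mathrm{colim}\,F_1$ and $\mathrm{colim}\,F_2$ exist in $\mathcal A$. Let $\eta:F_1\to F_2$ be a natural transformation such that $\eta(d):F_1(d)\to F_2(d)$ is a $\lambda$-embedding for each $d$ in $\mathcal D$. Then the induced morphism $f:\mathrm{colim}\,F_1\to\mathrm{colim}\,F_2$ is a $\lambda$-embedding.
   Context: Regular cardinals are infinite. A poset is $\lambda$-directed if every subset of cardinality $<\lambda$ has an upper bound; a $\lambda$-directed colimit of monomorphisms is a colimit of a diagram indexed by a $\lambda$-directed poset all of whose maps are monomorphisms. An object $G$ of a category $\mathcal A$ is $\lambda$-generated if $\hom(G,-):\mathcal A\to \mathrm{Set}$ preserves those $\lambda$-directed colimits of monomorphisms that exist in $\mathcal A$. The category $\mathcal A$ is $\lambda$-mono-generated if every object of $\mathcal A$ is a colimit of a $\lambda$-directed diagram consisting of monomorphisms and $\lambda$-generated objects. (It is not assumed that all $\lambda$-directed colimits of monomorphisms exist.) A span between objects $X,Y$ is a diagram $X\xleftarrow{x}U\xrightarrow{y}Y$ with both $x,y$ monomorphisms. A set $\{X\xleftarrow{x_i}U_i\xrightarrow{y_i}Y \mid i\in I\}$ of spans is $\lambda$-dense if it is non-empty and: (back) for all $i\in I$ and every monomorphism $g:G\to X$ with $G$ $\lambda$-generated, there exist $j\in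 I$ and morphisms $s:G\to U_j$, $w:U_i\to U_j$ with $x_js=g$, $x_jw=x_i$, $y_jw=y_i$; (forth) for all $i\in I$ and every monomorphism $g:G\to Y$ with $G$ $\lambda$-generated, there exist $j\in I$ and morphisms $s:G\to U_j$, $w:U_i\to U_j$ with $y_js=g$, $x_jw=x_i$, $y_jw=y_i$. A morphism $f:X\to Y$ is a $\lambda$-embedding if there is a $\lambda$-dense set $\mathcal S$ of spans between $X$ and $Y$ such that for every monomorphism $g:G\to X$ with $G$ $\lambda$-generated there exist a span $X\xleftarrow{u}U\xrightarrow{v}Y$ in $\mathcal S$ and $t:G\to U$ with $ut=g$ and $vt=fg$. *)

theory Defs
  imports Main "HOL-Library.FuncSet"
begin

unbundle cardinal_syntax

section \<open>Categories\<close>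

record ('o, 'm) category =
  Obj :: "'o set"
  Arr :: "'m set"
  Dom :: "'m \<Rightarrow> 'o"
  Cod :: "'m \<Rightarrow> 'o"
  Idt :: "'o \<Rightarrow> 'm"
  Comp :: "'m \<Rightarrow> 'm \<Rightarrow> 'm"  (infixl \<open>\<cdot>\<index>\<close> 70)

text \<open>Composition is written in the order of function composition: first \<open>f\<close>, then \<open>g\<close> in
  \<open>g \<cdot>\<^bsub>A\<^esub> f\<close>. All operations are only meaningful on \<open>Obj\<close>, \<open>Arr\<close> and composable pairs.\<close>

definition hom :: "('o, 'm) category \<Rightarrow> 'o \<Rightarrow> 'o \<Rightarrow> 'm set" where
  "hom A X Y = {f \<in> Arr A. Dom A f = X \<and> Cod A f = Y}"

definition category :: "('o, 'm) category \<Rightarrow> bool" where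
  "category A \<longleftrightarrow>
     (\<forall>f \<in> Arr A. Dom A f \<in> Obj A \<and> Cod A f \<in> Obj A) \<and>
     (\<forall>X \<in> Obj A. Idt A X \<in> hom A X X) \<and>
     (\<forall>X Y Z f g. f \<in> hom A X Y \<longrightarrow> g \<in> hom A Y Z \<longrightarrow> g \<cdot>\<^bsub>A\<^esub> f \<in> hom A X Z) \<and>
     (\<forall>X Y f. f \<in> hom A X Y \<longrightarrow> f \<cdot>\<^bsub>A\<^esub> Idt A X = f \<and> Idt A Y \<cdot>\<^bsub>A\<^esub> f = f) \<and>
     (\<forall>W X Y Z f g h. f \<in> hom A W X \<longrightarrow> g \<in> hom A X Y \<longrightarrow> h \<in> hom A Y Z \<longrightarrow>
        (h \<cdot>\<^bsub>A\<^esub> g) \<cdot>\<^bsub>A\<^esub> f = h \<cdot>\<^bsub>A\<^esub> (g \<cdot>\<^bsub>A\<^esub> f))"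

definition monic :: "('o, 'm) category \<Rightarrow> 'm \<Rightarrow> bool" where
  "monic A f \<longleftrightarrow> f \<in> Arr A \<and>
     (\<forall>Z g h. g \<in> hom A Z (Dom A f) \<longrightarrow> h \<in> hom A Z (Dom A f) \<longrightarrow>
        f \<cdot>\<^bsub>A\<^esub> g = f \<cdot>\<^bsub>A\<^esub> h \<longrightarrow> g = h)"

text \<open>The category of sets whose elements are taken from the type \<open>'x\<close>. An arrow is a triple
  (domain, codomain, graph), the graph being an extensional function.\<close>

definition set_cat :: "('x set, 'x set \<times> 'x set \<times> ('x \<Rightarrow> 'x)) category" where
  "set_cat = \<lparr>
     Obj = UNIV,
     Arr = {(S, T, f). f \<in> S \<rightarrow>\<^sub>E T},
     Dom = (\<lambda>(S, T, f). S),
     Cod = (\<lambda>(S, T, f). T),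
     Idt = (\<lambda>S. (S, S, \<lambda>x\<in>S. x)),
     Comp = (\<lambda>(_, T', g) (S, _, f). (S, T', \<lambda>x\<in>S. g (f x)))\<rparr>"

lemma category_set_cat: "category set_cat"
  unfolding category_def hom_def set_cat_def
  by (auto simp: PiE_def extensional_def fun_eq_iff)


section \<open>Diagrams indexed by posets, colimits\<close>

text \<open>A poset is given by its reflexive order relation \<open>r\<close>; its carrier is \<open>Field r\<close>.\<close>

definition directed_poset :: "'k rel \<Rightarrow> 'i rel \<Rightarrow> bool" where
  "directed_poset lam r \<longleftrightarrow> Partial_order r \<and>
     (\<forall>S. S \<subseteq> Field r \<longrightarrow> |S| <o lam \<longrightarrow> (\<exists>u \<in> Field r. \<forall>s \<in> S. (s, u) \<in> r))"

record ('i, 'o, 'm) diagram =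
  ob :: "'i \<Rightarrow> 'o"
  ar :: "'i \<Rightarrow> 'i \<Rightarrow> 'm"

text \<open>Functors from the poset \<open>r\<close> to \<open>A\<close>; \<open>ar F d e\<close> is the value at the unique arrow
  \<open>d \<rightarrow> e\<close>, meaningful only for \<open>(d, e) \<in> r\<close>.\<close>

definition poset_functor :: "'i rel \<Rightarrow> ('o, 'm) category \<Rightarrow> ('i, 'o, 'm) diagram \<Rightarrow> bool" where
  "poset_functor r A F \<longleftrightarrow>
     (\<forall>d \<in> Field r. ob F d \<in> Obj A) \<and>
     (\<forall>d e. (d, e) \<in> r \<longrightarrow> ar F d e \<in> hom A (ob F d) (ob F e)) \<and>
     (\<forall>d \<in> Field r. ar F d d = Idt A (ob F d)) \<and>
     (\<forall>c d e. (c, d) \<in> r \<longrightarrow> (d, e) \<in> r \<longrightarrow> ar F d e \<cdot>\<^bsub>A\<^esub> ar F c d = ar F c e)"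

definition natural_transformation ::
  "'i rel \<Rightarrow> ('o, 'm) category \<Rightarrow> ('i, 'o, 'm) diagram \<Rightarrow> ('i, 'o, 'm) diagram
     \<Rightarrow> ('i \<Rightarrow> 'm) \<Rightarrow> bool" where
  "natural_transformation r A F G \<eta> \<longleftrightarrow>
     (\<forall>d \<in> Field r. \<eta> d \<in> hom A (ob F d) (ob G d)) \<and>
     (\<forall>d e. (d, e) \<in> r \<longrightarrow> \<eta> e \<cdot>\<^bsub>A\<^esub> ar F d e = ar G d e \<cdot>\<^bsub>A\<^esub> \<eta> d)"

definition cocone ::
  "'i rel \<Rightarrow> ('o, 'm) category \<Rightarrow> ('i, 'o, 'm) diagram \<Rightarrow> 'o \<Rightarrow> ('i \<Rightarrow> 'm) \<Rightarrow> bool" where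
  "cocone r A F C k \<longleftrightarrow> C \<in> Obj A \<and>
     (\<forall>d \<in> Field r. k d \<in> hom A (ob F d) C) \<and>
     (\<forall>d e. (d, e) \<in> r \<longrightarrow> k e \<cdot>\<^bsub>A\<^esub> ar F d e = k d)"

definition colimit ::
  "'i rel \<Rightarrow> ('o, 'm) category \<Rightarrow> ('i, 'o, 'm) diagram \<Rightarrow> 'o \<Rightarrow> ('i \<Rightarrow> 'm) \<Rightarrow> bool" where
  "colimit r A F C k \<longleftrightarrow> cocone r A F C k \<and>
     (\<forall>Z q. cocone r A F Z q \<longrightarrow>
        (\<exists>!h. h \<in> hom A C Z \<and> (\<forall>d \<in> Field r. h \<cdot>\<^bsub>A\<^esub> k d = q d)))"

definition mono_diagram :: "'i rel \<Rightarrow> ('o, 'm) category \<Rightarrow> ('i, 'o, 'm) diagram \<Rightarrow> bool" where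
  "mono_diagram r A F \<longleftrightarrow> poset_functor r A F \<and> (\<forall>d e. (d, e) \<in> r \<longrightarrow> monic A (ar F d e))"


section \<open>Generated objects\<close>

text \<open>The action on arrows of the functor hom(G, -) from \<open>A\<close> to \<open>set_cat\<close>; its action on
  objects is \<open>hom A G\<close>.\<close>

definition hom_arr :: "('o, 'm) category \<Rightarrow> 'o \<Rightarrow> 'm \<Rightarrow> 'm set \<times> 'm set \<times> ('m \<Rightarrow> 'm)" where
  "hom_arr A G f =
     (hom A G (Dom A f), hom A G (Cod A f), \<lambda>h \<in> hom A G (Dom A f). f \<cdot>\<^bsub>A\<^esub> h)"

definition hom_diagram ::
  "('o, 'm) category \<Rightarrow> 'o \<Rightarrow> ('i, 'o, 'm) diagram
     \<Rightarrow> ('i, 'm set, 'm set \<times> 'm set \<times> ('m \<Rightarrow> 'm)) diagram" where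
  "hom_diagram A G F = \<lparr>ob = (\<lambda>d. hom A G (ob F d)), ar = (\<lambda>d e. hom_arr A G (ar F d e))\<rparr>"

text \<open>HOL cannot quantify over index types inside a definition. The size bound for index posets
  is therefore an explicit cardinal \<open>kap\<close>: small posets are those of cardinality less than \<open>kap\<close>.
  Every such poset is isomorphic to one on the carrier type of \<open>kap\<close>, so that taking
  \<open>r\<close> on that type is no further restriction.

  Colimits in Set are taken in \<open>set_cat\<close> over the type of arrows of \<open>A\<close>. Whether a cocone of
  sets is a colimit is already decided by its maps into a two-element set, so the universe of
  test sets is large enough. (If \<open>A\<close> has only one arrow, then G is its only object, every
  hom(G, F d) is the same singleton, and there is nothing to test.)\<close>

definition lam_generated :: "'i rel \<Rightarrow> 'k rel \<Rightarrow> ('o, 'm) category \<Rightarrow> 'o \<Rightarrow> bool" where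
  "lam_generated kap lam A G \<longleftrightarrow> G \<in> Obj A \<and>
     (\<forall>(r :: 'i rel) F C k.
        |Field r| <o kap \<longrightarrow> directed_poset lam r \<longrightarrow> mono_diagram r A F \<longrightarrow> colimit r A F C k \<longrightarrow>
        colimit r set_cat (hom_diagram A G F) (hom A G C) (\<lambda>d. hom_arr A G (k d)))"

definition lam_mono_generated :: "'i rel \<Rightarrow> 'k rel \<Rightarrow> ('o, 'm) category \<Rightarrow> bool" where
  "lam_mono_generated kap lam A \<longleftrightarrow>
     (\<forall>X \<in> Obj A. \<exists>(r :: 'i rel) F k.
        |Field r| <o kap \<and> directed_poset lam r \<and> mono_diagram r A F \<and>
        (\<forall>d \<in> Field r. lam_generated kap lam A (ob F d)) \<and> colimit r A F X k)"


section \<open>Spans and embeddings\<close>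

text \<open>A span from \<open>X\<close> to \<open>Y\<close> is represented by the pair of its legs.\<close>

definition span :: "('o, 'm) category \<Rightarrow> 'o \<Rightarrow> 'o \<Rightarrow> 'm \<times> 'm \<Rightarrow> bool" where
  "span A X Y = (\<lambda>(x, y). monic A x \<and> monic A y \<and> Dom A x = Dom A y \<and> Cod A x = X \<and> Cod A y = Y)"

definition lam_dense ::
  "'i rel \<Rightarrow> 'k rel \<Rightarrow> ('o, 'm) category \<Rightarrow> 'o \<Rightarrow> 'o \<Rightarrow> ('m \<times> 'm) set \<Rightarrow> bool" where
  "lam_dense kap lam A X Y S \<longleftrightarrow>
     S \<noteq> {} \<and> (\<forall>p \<in> S. span A X Y p) \<and>
     (\<forall>(x, y) \<in> S. \<forall>G g. lam_generated kap lam A G \<longrightarrow> g \<in> hom A G X \<longrightarrow> monic A g \<longrightarrow>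
        (\<exists>(x', y') \<in> S. \<exists>s \<in> hom A G (Dom A x'). \<exists>w \<in> hom A (Dom A x) (Dom A x').
           x' \<cdot>\<^bsub>A\<^esub> s = g \<and> x' \<cdot>\<^bsub>A\<^esub> w = x \<and> y' \<cdot>\<^bsub>A\<^esub> w = y)) \<and>
     (\<forall>(x, y) \<in> S. \<forall>G g. lam_generated kap lam A G \<longrightarrow> g \<in> hom A G Y \<longrightarrow> monic A g \<longrightarrow>
        (\<exists>(x', y') \<in> S. \<exists>s \<in> hom A G (Dom A x'). \<exists>w \<in> hom A (Dom A x) (Dom A x').
           y' \<cdot>\<^bsub>A\<^esub> s = g \<and> x' \<cdot>\<^bsub>A\<^esub> w = x \<and> y' \<cdot>\<^bsub>A\<^esub> w = y))"

definition lam_embedding :: "'i rel \<Rightarrow> 'k rel \<Rightarrow> ('o, 'm) category \<Rightarrow> 'm \<Rightarrow> bool" where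
  "lam_embedding kap lam A f \<longleftrightarrow> f \<in> Arr A \<and>
     (\<exists>S. lam_dense kap lam A (Dom A f) (Cod A f) S \<and>
        (\<forall>G g. lam_generated kap lam A G \<longrightarrow> g \<in> hom A G (Dom A f) \<longrightarrow> monic A g \<longrightarrow>
           (\<exists>(u, v) \<in> S. \<exists>t \<in> hom A G (Dom A u). u \<cdot>\<^bsub>A\<^esub> t = g \<and> v \<cdot>\<^bsub>A\<^esub> t = f \<cdot>\<^bsub>A\<^esub> g)))"

text \<open>The arrow between colimit objects induced by a natural transformation.\<close>

definition induced_arrow ::
  "'i rel \<Rightarrow> ('o, 'm) category \<Rightarrow> 'o \<Rightarrow> ('i \<Rightarrow> 'm) \<Rightarrow> 'o \<Rightarrow> ('i \<Rightarrow> 'm) \<Rightarrow> ('i \<Rightarrow> 'm) \<Rightarrow> 'm" where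
  "induced_arrow r A C k C' k' \<eta> =
     (THE f. f \<in> hom A C C' \<and> (\<forall>d \<in> Field r. f \<cdot>\<^bsub>A\<^esub> k d = k' d \<cdot>\<^bsub>A\<^esub> \<eta> d))"

end

theory Submission
  imports Defs
begin

text \<open>
  The infinitary logic behind the notion of a \<open>\<lambda>\<close>-embedding suggests the proof. Read a generated
  subobject \<open>g\<close> of \<open>X\<close> (a monomorphism into \<open>X\<close> with generated domain) as a tuple of fewer than
  \<open>\<lambda>\<close> elements of \<open>X\<close>. Call \<open>a\<close> in \<open>X\<close> and \<open>b\<close> in \<open>Y\<close> equivalent if they have the same domain and
  the span \<open>(a, b)\<close> belongs to some back-and-forth system consisting of generated subobjects of \<open>X\<close>
  and \<open>Y\<close>; this stands for "\<open>a\<close> and \<open>b\<close> satisfy the same formulas". The union \<open>bf_equiv X Y\<close> of all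
  such systems is again one. It is symmetric, stable under restriction to generated subobjects, and
  transitive, where transitivity (\<open>bf_equiv_trans\<close>) rests on stability under restriction.

  The spans of a dense set may have large apexes, but restricting them to the generated subobjects of
  their apexes leaves a back-and-forth system (\<open>bf_system_restrictions\<close>). Hence \<open>f\<close> is an embedding
  if and only if \<open>g\<close> and \<open>f g\<close> are equivalent for every generated subobject \<open>g\<close> of its domain
  (\<open>lam_embeddingD\<close>, \<open>lam_embeddingI\<close>): an embedding is an elementary map. In particular embeddings
  are monomorphisms, so the two given diagrams consist of monomorphisms and generated objects see
  their colimits.

  The colimit then behaves like the union of an elementary chain: the colimit injections are
  embeddings (\<open>colimit_injection_embedding\<close>). Given a generated subobject \<open>g\<close> of the first colimit,
  write \<open>g = k1 d g'\<close> for some \<open>d\<close>. Then \<open>g\<close>, \<open>g'\<close>, \<open>\<eta> d g'\<close> and \<open>k2 d (\<eta> d g')\<close> are equivalent,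
  each to the next, because \<open>k1 d\<close>, \<open>\<eta> d\<close> and \<open>k2 d\<close> are embeddings, and the last one is \<open>f g\<close> for the
  induced arrow \<open>f\<close>. So \<open>f\<close> is elementary.
\<close>

section \<open>Categories and monomorphisms\<close>

locale cat =
  fixes A :: "('o, 'm) category" (structure)
  assumes category: "category A"
begin

lemma arr_in_hom: "f \<in> Arr A \<Longrightarrow> f \<in> hom A (Dom A f) (Cod A f)"
  by (simp add: hom_def)

lemma homD: "f \<in> hom A X Y \<Longrightarrow> f \<in> Arr A \<and> Dom A f = X \<and> Cod A f = Y"
  by (simp add: hom_def)

lemma hom_obj: "f \<in> hom A X Y \<Longrightarrow> X \<in> Obj A \<and> Y \<in> Obj A"
  using category unfolding category_def hom_def by auto

lemma comp_in: "f \<in> hom A X Y \<Longrightarrow> g \<in> hom A Y Z \<Longrightarrow> g \<cdot> f \<in> hom A X Z"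
  using category unfolding category_def by blast

lemma assoc:
  "f \<in> hom A W X \<Longrightarrow> g \<in> hom A X Y \<Longrightarrow> h \<in> hom A Y Z \<Longrightarrow> (h \<cdot> g) \<cdot> f = h \<cdot> (g \<cdot> f)"
  using category unfolding category_def by blast

lemma idt_in: "X \<in> Obj A \<Longrightarrow> Idt A X \<in> hom A X X"
  using category unfolding category_def by blast

lemma comp_idt: "f \<in> hom A X Y \<Longrightarrow> f \<cdot> Idt A X = f"
  using category unfolding category_def by blast

lemma monicI:
  assumes "f \<in> hom A X Y"
    and "\<And>Z g h. g \<in> hom A Z X \<Longrightarrow> h \<in> hom A Z X \<Longrightarrow> f \<cdot> g = f \<cdot> h \<Longrightarrow> g = h"
  shows "monic A f"
  using assms homD[OF assms(1)] unfolding monic_def by auto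

lemma monicD:
  assumes "monic A f" "f \<in> hom A X Y" "g \<in> hom A Z X" "h \<in> hom A Z X" "f \<cdot> g = f \<cdot> h"
  shows "g = h"
  using assms homD[OF assms(2)] unfolding monic_def by blast

lemma monic_in_hom: "monic A f \<Longrightarrow> f \<in> hom A (Dom A f) (Cod A f)"
  by (simp add: monic_def hom_def)

lemma monic_comp:
  assumes f: "f \<in> hom A X Y" "monic A f" and g: "g \<in> hom A Y Z" "monic A g"
  shows "monic A (g \<cdot> f)"
proof (rule monicI[OF comp_in[OF f(1) g(1)]])
  fix W p q assume pq: "p \<in> hom A W X" "q \<in> hom A W X" "(g \<cdot> f) \<cdot> p = (g \<cdot> f) \<cdot> q"
  then have "g \<cdot> (f \<cdot> p) = g \<cdot> (f \<cdot> q)" using assoc f g by metis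
  then have "f \<cdot> p = f \<cdot> q" using monicD[OF g(2,1)] comp_in f pq by blast
  then show "p = q" using monicD[OF f(2,1)] pq by blast
qed

lemma monic_cancel:
  assumes f: "f \<in> hom A X Y" and g: "g \<in> hom A Y Z" and gf: "monic A (g \<cdot> f)"
  shows "monic A f"
proof (rule monicI[OF f])
  fix W p q assume pq: "p \<in> hom A W X" "q \<in> hom A W X" "f \<cdot> p = f \<cdot> q"
  then have "(g \<cdot> f) \<cdot> p = (g \<cdot> f) \<cdot> q" using assoc f g by metis
  then show "p = q" using monicD[OF gf comp_in[OF f g]] pq by blast
qed

end


section \<open>Directed posets and colimits\<close>

lemma ex1_unique: "\<exists>!x. P x \<Longrightarrow> P a \<Longrightarrow> P b \<Longrightarrow> a = b"
  using the1_equality[of P a] the1_equality[of P b] by simp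

lemma finite_ordLess_Cinfinite: "Cinfinite lam \<Longrightarrow> finite S \<Longrightarrow> |S| <o lam"
  using card_of_Well_order[of S] card_order_on_well_order_on[of "Field lam" lam]
  by (intro finite_ordLess_infinite) (simp_all add: cinfinite_def Field_card_of)

lemma directed_poset_ub:
  assumes lam: "Cinfinite lam" and dir: "directed_poset lam r" and S: "S \<subseteq> Field r" "finite S"
  obtains u where "u \<in> Field r" "\<forall>s \<in> S. (s, u) \<in> r"
proof -
  have "\<exists>u \<in> Field r. \<forall>s \<in> S. (s, u) \<in> r"
    using dir S(1) finite_ordLess_Cinfinite[OF lam S(2)] unfolding directed_poset_def by simp
  then show ?thesis using that by blast
qed

lemma directed_poset_ub2:
  assumes "Cinfinite lam" "directed_poset lam r" "a \<in> Field r" "b \<in> Field r"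
  obtains u where "(a, u) \<in> r" "(b, u) \<in> r"
proof -
  have "{a, b} \<subseteq> Field r" "finite {a, b}" using assms(3,4) by auto
  then obtain u where "u \<in> Field r" "\<forall>s \<in> {a, b}. (s, u) \<in> r"
    by (rule directed_poset_ub[OF assms(1,2)])
  then show ?thesis using that by blast
qed

lemma directed_poset_nonempty:
  assumes "Cinfinite lam" "directed_poset lam r"
  obtains a where "a \<in> Field r"
  by (rule directed_poset_ub[OF assms, of "{}"]) simp_all

lemma directed_poset_refl: "directed_poset lam r \<Longrightarrow> a \<in> Field r \<Longrightarrow> (a, a) \<in> r"
  unfolding directed_poset_def partial_order_on_def preorder_on_def refl_on_def by auto

lemma directed_poset_trans:
  "directed_poset lam r \<Longrightarrow> (a, b) \<in> r \<Longrightarrow> (b, c) \<in> r \<Longrightarrow> (a, c) \<in> r"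
  unfolding directed_poset_def partial_order_on_def preorder_on_def trans_def by blast

context cat
begin

lemma colimitD:
  assumes "colimit r A F C k"
  shows "C \<in> Obj A" "\<And>d. d \<in> Field r \<Longrightarrow> k d \<in> hom A (ob F d) C"
    "\<And>d e. (d, e) \<in> r \<Longrightarrow> k e \<cdot> ar F d e = k d"
  using assms unfolding colimit_def cocone_def by auto

lemma colimit_eqI:
  assumes col: "colimit r A F C k" and p: "p \<in> hom A C Z" and q: "q \<in> hom A C Z"
    and eq: "\<And>d. d \<in> Field r \<Longrightarrow> p \<cdot> k d = q \<cdot> k d"
    and F: "\<And>d e. (d, e) \<in> r \<Longrightarrow> ar F d e \<in> hom A (ob F d) (ob F e)"
  shows "p = q"
proof -
  note k = colimitD[OF col]
  have "cocone r A F Z (\<lambda>d. p \<cdot> k d)"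
    unfolding cocone_def
  proof (intro conjI allI ballI impI)
    show "Z \<in> Obj A" using hom_obj p by blast
    show "p \<cdot> k d \<in> hom A (ob F d) Z" if "d \<in> Field r" for d
      using comp_in k p that by blast
    show "(p \<cdot> k e) \<cdot> ar F d e = p \<cdot> k d" if "(d, e) \<in> r" for d e
      using assoc[OF F[OF that] k(2) p] k(3)[OF that] that by (auto simp: Field_def)
  qed
  then have "\<exists>!h. h \<in> hom A C Z \<and> (\<forall>d\<in>Field r. h \<cdot> k d = p \<cdot> k d)"
    using col unfolding colimit_def by blast
  then show ?thesis using p q eq by (metis (lifting))
qed

lemma set_comp_hom_arr:
  assumes "f \<in> hom A X Y"
  shows "(hom A G Y, Z, t) \<cdot>\<^bsub>set_cat\<^esub> hom_arr A G f
    = (hom A G X, Z, \<lambda>x\<in>hom A G X. t (f \<cdot> x))"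
  using homD[OF assms] unfolding hom_arr_def set_cat_def by (simp add: fun_eq_iff)

text \<open>The universal property of a colimit of hom-sets, with the arrows of \<open>set_cat\<close> unpacked into
  functions. Generatedness of \<open>G\<close> is exploited by
  choosing the functions \<open>q d\<close> into a two-element set \<open>Z\<close>.\<close>

lemma set_colimit_map:
  fixes Z :: "'m set"
  assumes col: "colimit r set_cat (hom_diagram A G F) (hom A G C) (\<lambda>d. hom_arr A G (k d))"
    and F: "\<And>d e. (d, e) \<in> r \<Longrightarrow> ar F d e \<in> hom A (ob F d) (ob F e)"
    and k: "\<And>d. d \<in> Field r \<Longrightarrow> k d \<in> hom A (ob F d) C"
    and q: "\<And>d x. d \<in> Field r \<Longrightarrow> x \<in> hom A G (ob F d) \<Longrightarrow> q d x \<in> Z"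
    and q_compat: "\<And>d e x. (d, e) \<in> r \<Longrightarrow> x \<in> hom A G (ob F d) \<Longrightarrow> q e (ar F d e \<cdot> x) = q d x"
  shows "\<exists>!t. t \<in> hom A G C \<rightarrow>\<^sub>E Z \<and>
    (\<forall>d\<in>Field r. \<forall>x\<in>hom A G (ob F d). t (k d \<cdot> x) = q d x)"
proof -
  let ?q = "\<lambda>d. (hom A G (ob F d), Z, \<lambda>x\<in>hom A G (ob F d). q d x)"
  have hom_set: "h \<in> hom set_cat S T \<longleftrightarrow> (\<exists>t. h = (S, T, t) \<and> t \<in> S \<rightarrow>\<^sub>E T)"
    for h :: "'m set \<times> 'm set \<times> ('m \<Rightarrow> 'm)" and S T
    by (cases h) (auto simp: hom_def set_cat_def)
  have "cocone r set_cat (hom_diagram A G F) Z ?q"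
    unfolding cocone_def
  proof (intro conjI allI ballI impI)
    show "Z \<in> Obj set_cat" by (simp add: set_cat_def)
    show "?q d \<in> hom set_cat (ob (hom_diagram A G F) d) Z" if "d \<in> Field r" for d
      unfolding hom_set using q that by (auto simp: hom_diagram_def)
    show "?q e \<cdot>\<^bsub>set_cat\<^esub> ar (hom_diagram A G F) d e = ?q d" if "(d, e) \<in> r" for d e
    proof -
      have "(\<lambda>x\<in>hom A G (ob F d). (\<lambda>x\<in>hom A G (ob F e). q e x) (ar F d e \<cdot> x))
          = (\<lambda>x\<in>hom A G (ob F d). q d x)"
        using comp_in[OF _ F[OF that]] q_compat[OF that] by (intro restrict_ext) simp
      then show ?thesis
        unfolding hom_diagram_def by (simp add: set_comp_hom_arr[OF F[OF that]])
    qed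
  qed
  then have ex: "\<exists>!h. h \<in> hom set_cat (hom A G C) Z \<and>
      (\<forall>d\<in>Field r. h \<cdot>\<^bsub>set_cat\<^esub> hom_arr A G (k d) = ?q d)"
    using col unfolding colimit_def by blast
  have fac: "(hom A G C, Z, t) \<cdot>\<^bsub>set_cat\<^esub> hom_arr A G (k d) = ?q d \<longleftrightarrow>
      (\<forall>x\<in>hom A G (ob F d). t (k d \<cdot> x) = q d x)" if "d \<in> Field r" for t d
    unfolding set_comp_hom_arr[OF k[OF that]] by (auto simp: fun_eq_iff restrict_def)
  show ?thesis
  proof (rule ex_ex1I)
    show "\<exists>t. t \<in> hom A G C \<rightarrow>\<^sub>E Z \<and> (\<forall>d\<in>Field r. \<forall>x\<in>hom A G (ob F d). t (k d \<cdot> x) = q d x)"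
      using ex1_implies_ex[OF ex] fac unfolding hom_set by blast
  next
    fix t t'
    assume t: "t \<in> hom A G C \<rightarrow>\<^sub>E Z \<and> (\<forall>d\<in>Field r. \<forall>x\<in>hom A G (ob F d). t (k d \<cdot> x) = q d x)"
      and t': "t' \<in> hom A G C \<rightarrow>\<^sub>E Z \<and> (\<forall>d\<in>Field r. \<forall>x\<in>hom A G (ob F d). t' (k d \<cdot> x) = q d x)"
    have "(hom A G C, Z, t) = (hom A G C, Z, t')"
    proof (rule ex1_unique[OF ex])
      show "(hom A G C, Z, t) \<in> hom set_cat (hom A G C) Z \<and>
          (\<forall>d\<in>Field r. (hom A G C, Z, t) \<cdot>\<^bsub>set_cat\<^esub> hom_arr A G (k d) = ?q d)"
        using t fac unfolding hom_set by blast
      show "(hom A G C, Z, t') \<in> hom set_cat (hom A G C) Z \<and>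
          (\<forall>d\<in>Field r. (hom A G C, Z, t') \<cdot>\<^bsub>set_cat\<^esub> hom_arr A G (k d) = ?q d)"
        using t' fac unfolding hom_set by blast
    qed
    then show "t = t'" by simp
  qed
qed

end

section \<open>Generated objects and colimits of monomorphisms\<close>

locale mono_generated_cat = cat A for A :: "('o, 'm) category" (structure) +
  fixes kap :: "'i rel" and lam :: "'k rel"
  assumes Cinf: "Cinfinite lam" and mono_generated: "lam_mono_generated kap lam A"
begin

abbreviation gen :: "'o \<Rightarrow> bool" where
  "gen \<equiv> lam_generated kap lam A"

text \<open>Otherwise the map collapsing \<open>hom A G C\<close> to a point and its modification at \<open>h\<close> would be two
  different maps into a two-element set that agree on all arrows factoring through the diagram.
  The two elements are taken from the type of arrows; if that type is a singleton, the category has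
  a single arrow, which factors through itself.\<close>

lemma generated_factors:
  fixes r :: "'i rel"
  assumes small: "|Field r| <o kap" and dir: "directed_poset lam r" and F: "mono_diagram r A F"
    and col: "colimit r A F C k" and G: "gen G" and h: "h \<in> hom A G C"
  shows "\<exists>d\<in>Field r. \<exists>h'\<in>hom A G (ob F d). h = k d \<cdot> h'"
proof (cases "\<forall>p q :: 'm. p = q")
  case True
  obtain d where d: "d \<in> Field r" using directed_poset_nonempty[OF Cinf dir] .
  have kd: "k d \<in> hom A (ob F d) C" using colimitD(2)[OF col] d .
  have "k d = h" using True by blast
  then have "ob F d = G" using kd h by (auto simp: hom_def)
  then show ?thesis using d True hom_obj[OF kd] idt_in by blast
next
  case False
  then obtain p q :: 'm where pq: "p \<noteq> q" by blast
  have Fhom: "\<And>d e. (d, e) \<in> r \<Longrightarrow> ar F d e \<in> hom A (ob F d) (ob F e)"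
    using F unfolding mono_diagram_def poset_functor_def by blast
  have setcol: "colimit r set_cat (hom_diagram A G F) (hom A G C) (\<lambda>d. hom_arr A G (k d))"
    using G small dir F col unfolding lam_generated_def by blast
  have ex: "\<exists>!t. t \<in> hom A G C \<rightarrow>\<^sub>E {p, q} \<and>
    (\<forall>d\<in>Field r. \<forall>x\<in>hom A G (ob F d). t (k d \<cdot> x) = (\<lambda>d x. p) d x)"
    by (rule set_colimit_map[OF setcol Fhom colimitD(2)[OF col]]) auto
  show ?thesis
  proof (rule ccontr)
    assume no: "\<not> ?thesis"
    let ?t = "\<lambda>x\<in>hom A G C. p" and ?t' = "\<lambda>x\<in>hom A G C. if x = h then q else p"
    have "k d \<cdot> x \<in> hom A G C" if "d \<in> Field r" "x \<in> hom A G (ob F d)" for d x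
      using comp_in colimitD(2)[OF col] that by blast
    then have "?t = ?t'" using no by (intro ex1_unique[OF ex]) auto
    then have "?t h = ?t' h" by (rule fun_cong)
    then show False using pq h by simp
  qed
qed

text \<open>Two arrows identified in the colimit are identified at some later stage, as in any directed
  colimit of sets, and the transition maps are monic. The separating map into \<open>{h1, h2}\<close> asks
  whether an arrow eventually agrees with \<open>h1\<close>.\<close>

lemma generated_cancel:
  fixes r :: "'i rel"
  assumes small: "|Field r| <o kap" and dir: "directed_poset lam r" and F: "mono_diagram r A F"
    and col: "colimit r A F C k" and G: "gen G" and d: "d \<in> Field r"
    and h1: "h1 \<in> hom A G (ob F d)" and h2: "h2 \<in> hom A G (ob F d)"
    and eq: "k d \<cdot> h1 = k d \<cdot> h2"
  shows "h1 = h2"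
proof (rule ccontr)
  assume ne: "h1 \<noteq> h2"
  have Fhom: "\<And>d e. (d, e) \<in> r \<Longrightarrow> ar F d e \<in> hom A (ob F d) (ob F e)"
    and Fcomp: "\<And>c d e. (c, d) \<in> r \<Longrightarrow> (d, e) \<in> r \<Longrightarrow> ar F d e \<cdot> ar F c d = ar F c e"
    and Fmono: "\<And>d e. (d, e) \<in> r \<Longrightarrow> monic A (ar F d e)"
    using F unfolding mono_diagram_def poset_functor_def by blast+
  have push: "ar F b c \<cdot> (ar F a b \<cdot> x) = ar F a c \<cdot> x"
    if "(a, b) \<in> r" "(b, c) \<in> r" "x \<in> hom A G (ob F a)" for a b c x
    using assoc[OF that(3) Fhom[OF that(1)] Fhom[OF that(2)]] Fcomp[OF that(1,2)] by simp
  have setcol: "colimit r set_cat (hom_diagram A G F) (hom A G C) (\<lambda>d. hom_arr A G (k d))"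
    using G small dir F col unfolding lam_generated_def by blast
  \<comment> \<open>\<open>P e x\<close>: \<open>x\<close> and \<open>h1\<close> become equal at some stage; this is invariant under transition maps.\<close>
  define P where "P e x \<longleftrightarrow> (\<exists>u. (e, u) \<in> r \<and> (d, u) \<in> r \<and> ar F e u \<cdot> x = ar F d u \<cdot> h1)" for e x
  have P: "P e' (ar F e e' \<cdot> x) \<longleftrightarrow> P e x" if e: "(e, e') \<in> r" and x: "x \<in> hom A G (ob F e)" for e e' x
  proof
    assume "P e' (ar F e e' \<cdot> x)"
    then obtain u where "(e', u) \<in> r" "(d, u) \<in> r" "ar F e' u \<cdot> (ar F e e' \<cdot> x) = ar F d u \<cdot> h1"
      unfolding P_def by blast
    then show "P e x"
      unfolding P_def using push[OF e _ x] directed_poset_trans[OF dir e] by metis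
  next
    assume "P e x"
    then obtain u where u: "(e, u) \<in> r" "(d, u) \<in> r" "ar F e u \<cdot> x = ar F d u \<cdot> h1"
      unfolding P_def by blast
    have "e' \<in> Field r" "u \<in> Field r" using e u by (auto simp: Field_def)
    then obtain v where v: "(e', v) \<in> r" "(u, v) \<in> r" using directed_poset_ub2[OF Cinf dir] by blast
    have "ar F e' v \<cdot> (ar F e e' \<cdot> x) = ar F u v \<cdot> (ar F e u \<cdot> x)"
      using push[OF e v(1) x] push[OF u(1) v(2) x] by simp
    also have "\<dots> = ar F d v \<cdot> h1"
      using u(3) push[OF u(2) v(2) h1] by simp
    finally show "P e' (ar F e e' \<cdot> x)"
      unfolding P_def using v(1) directed_poset_trans[OF dir u(2) v(2)] by blast
  qed
  have "\<exists>!t. t \<in> hom A G C \<rightarrow>\<^sub>E {h1, h2} \<and>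
    (\<forall>e\<in>Field r. \<forall>x\<in>hom A G (ob F e). t (k e \<cdot> x) = (if P e x then h1 else h2))"
    by (rule set_colimit_map[OF setcol Fhom colimitD(2)[OF col]]) (auto simp: P)
  then obtain t where t: "\<forall>x\<in>hom A G (ob F d). t (k d \<cdot> x) = (if P d x then h1 else h2)"
    using d by blast
  have "P d h1" unfolding P_def using directed_poset_refl[OF dir d] by blast
  moreover have "\<not> P d h2"
    unfolding P_def using monicD[OF Fmono Fhom h2 h1] ne by blast
  ultimately have "h1 = h2" using t h1 h2 eq by metis
  then show False using ne by simp
qed

lemma generated_presentation:
  assumes "X \<in> Obj A"
  obtains r :: "'i rel" and F k where "|Field r| <o kap" "directed_poset lam r"
    "mono_diagram r A F" "colimit r A F X k" "\<forall>d\<in>Field r. gen (ob F d)"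
  using mono_generated[unfolded lam_mono_generated_def, rule_format, OF assms]
  by (elim exE conjE) (rule that)

text \<open>An object is a colimit of generated ones, and colimit injections are jointly epic. So
  monomorphisms can be tested on generated objects.\<close>

lemma generated_jointly_epic:
  assumes p: "p \<in> hom A X Y" and q: "q \<in> hom A X Y"
    and eq: "\<And>G m. gen G \<Longrightarrow> m \<in> hom A G X \<Longrightarrow> p \<cdot> m = q \<cdot> m"
  shows "p = q"
proof -
  obtain r :: "'i rel" and F k where r: "|Field r| <o kap" "directed_poset lam r"
    "mono_diagram r A F" "colimit r A F X k" and gF: "\<forall>d\<in>Field r. gen (ob F d)"
    by (rule generated_presentation[of X]) (use hom_obj[OF p] in blast)+
  show ?thesis
  proof (rule colimit_eqI[OF r(4) p q])
    show "p \<cdot> k d = q \<cdot> k d" if "d \<in> Field r" for d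
      using eq gF colimitD(2)[OF r(4)] that by blast
    show "ar F d e \<in> hom A (ob F d) (ob F e)" if "(d, e) \<in> r" for d e
      using r(3) that unfolding mono_diagram_def poset_functor_def by blast
  qed
qed

lemma monicI_generated:
  assumes f: "f \<in> hom A X Y"
    and inj: "\<And>G p q. gen G \<Longrightarrow> p \<in> hom A G X \<Longrightarrow> q \<in> hom A G X \<Longrightarrow> f \<cdot> p = f \<cdot> q \<Longrightarrow> p = q"
  shows "monic A f"
proof (rule monicI[OF f])
  fix Z g h assume gh: "g \<in> hom A Z X" "h \<in> hom A Z X" "f \<cdot> g = f \<cdot> h"
  show "g = h"
  proof (rule generated_jointly_epic[OF gh(1,2)])
    fix G m assume G: "gen G" and m: "m \<in> hom A G Z"
    have "f \<cdot> (g \<cdot> m) = f \<cdot> (h \<cdot> m)"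
      using assoc[OF m gh(1) f] assoc[OF m gh(2) f] gh(3) by simp
    then show "g \<cdot> m = h \<cdot> m" using inj[OF G] comp_in m gh by blast
  qed
qed

text \<open>In an arbitrary category the injections into a directed colimit of monomorphisms need not be
  monic. Here they are, since cancellation against generated objects suffices.\<close>

lemma colimit_injection_monic:
  fixes r :: "'i rel"
  assumes "|Field r| <o kap" "directed_poset lam r" "mono_diagram r A F"
    "colimit r A F C k" "d \<in> Field r"
  shows "monic A (k d)"
  using monicI_generated[OF colimitD(2)[OF assms(4,5)]] generated_cancel[OF assms(1-4) _ assms(5)]
  by blast

section \<open>Generated subobjects\<close>

text \<open>The categorical substitute for tuples of fewer than \<open>\<lambda>\<close> elements.\<close>

definition gsub :: "'o \<Rightarrow> 'm set" where
  "gsub X = {g. monic A g \<and> gen (Dom A g) \<and> Cod A g = X}"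

lemma gsub_hom: "g \<in> gsub X \<Longrightarrow> g \<in> hom A (Dom A g) X"
  using monic_in_hom by (auto simp: gsub_def)

lemma gsubI: "g \<in> hom A G X \<Longrightarrow> gen G \<Longrightarrow> monic A g \<Longrightarrow> g \<in> gsub X"
  by (auto simp: gsub_def hom_def)

lemma gsub_monic: "g \<in> gsub X \<Longrightarrow> monic A g"
  and gsub_gen: "g \<in> gsub X \<Longrightarrow> gen (Dom A g)"
  by (auto simp: gsub_def)

lemma gsub_comp:
  assumes "h \<in> gsub U" "x \<in> hom A U X" "monic A x"
  shows "x \<cdot> h \<in> gsub X" "Dom A (x \<cdot> h) = Dom A h"
  using comp_in[OF gsub_hom[OF assms(1)] assms(2)]
    monic_comp[OF gsub_hom[OF assms(1)] _ assms(2,3)] assms(1)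
  by (auto simp: gsub_def hom_def)

lemma gsub_cancel:
  assumes g: "g \<in> gsub X" and t: "t \<in> hom A (Dom A g) U" and u: "u \<in> hom A U X" "u \<cdot> t = g"
  shows "t \<in> gsub U"
  using monic_cancel[OF t u(1)] gsubI[OF t gsub_gen[OF g]] gsub_monic[OF g] u(2) by blast

text \<open>Any two small parts of an object lie in a common small subobject, because the presenting
  diagram is directed and its colimit injections are monic.\<close>

lemma gsub_factors2:
  assumes G1: "gen G1" "h1 \<in> hom A G1 X" and G2: "gen G2" "h2 \<in> hom A G2 X"
  obtains g m1 m2 where "g \<in> gsub X" "m1 \<in> hom A G1 (Dom A g)" "m2 \<in> hom A G2 (Dom A g)"
    "g \<cdot> m1 = h1" "g \<cdot> m2 = h2"
proof -
  obtain r :: "'i rel" and F k where r: "|Field r| <o kap" "directed_poset lam r"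
    "mono_diagram r A F" "colimit r A F X k" and gF: "\<forall>d\<in>Field r. gen (ob F d)"
    by (rule generated_presentation[of X]) (use hom_obj[OF G1(2)] in blast)+
  have Fhom: "\<And>d e. (d, e) \<in> r \<Longrightarrow> ar F d e \<in> hom A (ob F d) (ob F e)"
    using r(3) unfolding mono_diagram_def poset_functor_def by blast
  obtain d1 m1 where 1: "d1 \<in> Field r" "m1 \<in> hom A G1 (ob F d1)" "h1 = k d1 \<cdot> m1"
    using generated_factors[OF r G1] by blast
  obtain d2 m2 where 2: "d2 \<in> Field r" "m2 \<in> hom A G2 (ob F d2)" "h2 = k d2 \<cdot> m2"
    using generated_factors[OF r G2] by blast
  obtain e where e: "(d1, e) \<in> r" "(d2, e) \<in> r"
    using directed_poset_ub2[OF Cinf r(2) 1(1) 2(1)] .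
  then have eF: "e \<in> Field r" by (auto simp: Field_def)
  have ke: "k e \<in> hom A (ob F e) X" using colimitD(2)[OF r(4) eF] .
  show ?thesis
  proof (rule that)
    show "k e \<in> gsub X" using gsubI[OF ke] gF eF colimit_injection_monic[OF r eF] by blast
    have "Dom A (k e) = ob F e" using ke by (simp add: hom_def)
    then show "ar F d1 e \<cdot> m1 \<in> hom A G1 (Dom A (k e))" "ar F d2 e \<cdot> m2 \<in> hom A G2 (Dom A (k e))"
      using comp_in 1 2 Fhom e by metis+
    show "k e \<cdot> (ar F d1 e \<cdot> m1) = h1"
      using assoc[OF 1(2) Fhom[OF e(1)] ke] colimitD(3)[OF r(4) e(1)] 1(3) by simp
    show "k e \<cdot> (ar F d2 e \<cdot> m2) = h2"
      using assoc[OF 2(2) Fhom[OF e(2)] ke] colimitD(3)[OF r(4) e(2)] 2(3) by simp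
  qed
qed

lemma gsub_nonempty:
  assumes "X \<in> Obj A"
  obtains g where "g \<in> gsub X"
proof -
  obtain r :: "'i rel" and F k where r: "|Field r| <o kap" "directed_poset lam r"
    "mono_diagram r A F" "colimit r A F X k" and gF: "\<forall>d\<in>Field r. gen (ob F d)"
    by (rule generated_presentation[of X]) (use assms in blast)+
  obtain d where "d \<in> Field r" using directed_poset_nonempty[OF Cinf r(2)] .
  then show ?thesis
    using that gsubI[OF colimitD(2)[OF r(4)]] gF colimit_injection_monic[OF r] by blast
qed


section \<open>Back-and-forth equivalence of generated subobjects\<close>

text \<open>The "back" half of density, for spans of arbitrary apex. The "forth" half is the same condition on
  the converse relation, so that each argument about it is made only once.\<close>

definition extends :: "'o \<Rightarrow> 'm rel \<Rightarrow> bool" where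
  "extends X S \<longleftrightarrow> (\<forall>(x, y) \<in> S. \<forall>G g. gen G \<longrightarrow> g \<in> hom A G X \<longrightarrow> monic A g \<longrightarrow>
     (\<exists>(x', y') \<in> S. \<exists>s \<in> hom A G (Dom A x'). \<exists>w \<in> hom A (Dom A x) (Dom A x').
       x' \<cdot> s = g \<and> x' \<cdot> w = x \<and> y' \<cdot> w = y))"

lemma extendsD:
  assumes ext: "extends X S" and S: "(x, y) \<in> S" and g: "g \<in> gsub X"
  obtains x' y' s w where "(x', y') \<in> S" "s \<in> hom A (Dom A g) (Dom A x')"
    "w \<in> hom A (Dom A x) (Dom A x')" "x' \<cdot> s = g" "x' \<cdot> w = x" "y' \<cdot> w = y"
proof -
  have "\<exists>(x', y') \<in> S. \<exists>s \<in> hom A (Dom A g) (Dom A x'). \<exists>w \<in> hom A (Dom A x) (Dom A x').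
       x' \<cdot> s = g \<and> x' \<cdot> w = x \<and> y' \<cdot> w = y"
    using bspec[OF ext[unfolded extends_def] S, unfolded prod.case]
      gsub_gen[OF g] gsub_hom[OF g] gsub_monic[OF g] by blast
  then show ?thesis using that by blast
qed

lemma extendsI:
  assumes "\<And>x y g. (x, y) \<in> S \<Longrightarrow> g \<in> gsub X \<Longrightarrow> \<exists>x' y' s w. (x', y') \<in> S \<and>
     s \<in> hom A (Dom A g) (Dom A x') \<and> w \<in> hom A (Dom A x) (Dom A x') \<and>
     x' \<cdot> s = g \<and> x' \<cdot> w = x \<and> y' \<cdot> w = y"
  shows "extends X S"
proof -
  have "\<exists>(x', y') \<in> S. \<exists>s \<in> hom A G (Dom A x'). \<exists>w \<in> hom A (Dom A x) (Dom A x').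
       x' \<cdot> s = g \<and> x' \<cdot> w = x \<and> y' \<cdot> w = y"
    if S: "(x, y) \<in> S" and g: "gen G" "g \<in> hom A G X" "monic A g" for x y G g
  proof -
    have "Dom A g = G" using homD[OF g(2)] by simp
    then show ?thesis using assms[OF S gsubI[OF g(2,1,3)]] by blast
  qed
  then show ?thesis unfolding extends_def by blast
qed

text \<open>The forth clause of density refers to the apex as the domain of the first leg, whereas the
  converse relation takes it from the second one; both legs of a span share it.\<close>

lemma extends_converse_iff:
  assumes sp: "\<forall>p \<in> S. span A X Y p"
  shows "extends Y (S\<inverse>) \<longleftrightarrow> (\<forall>(x, y) \<in> S. \<forall>G g. gen G \<longrightarrow> g \<in> hom A G Y \<longrightarrow> monic A g \<longrightarrow>
     (\<exists>(x', y') \<in> S. \<exists>s \<in> hom A G (Dom A x'). \<exists>w \<in> hom A (Dom A x) (Dom A x').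
       y' \<cdot> s = g \<and> x' \<cdot> w = x \<and> y' \<cdot> w = y))"
    (is "_ \<longleftrightarrow> ?R")
proof -
  have dom: "Dom A x = Dom A y" if "(x, y) \<in> S" for x y
    using sp that unfolding span_def by auto
  have ?R if ext: "extends Y (S\<inverse>)"
  proof -
    have "\<exists>(x', y') \<in> S. \<exists>s \<in> hom A G (Dom A x'). \<exists>w \<in> hom A (Dom A x) (Dom A x').
         y' \<cdot> s = g \<and> x' \<cdot> w = x \<and> y' \<cdot> w = y"
      if xy: "(x, y) \<in> S" and g: "gen G" "g \<in> hom A G Y" "monic A g" for x y G g
    proof -
      have dg: "Dom A g = G" using homD[OF g(2)] by simp
      have "(y, x) \<in> S\<inverse>" using xy by simp
      then obtain y' x' s w where "(y', x') \<in> S\<inverse>" "s \<in> hom A (Dom A g) (Dom A y')"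
        "w \<in> hom A (Dom A y) (Dom A y')" "y' \<cdot> s = g" "y' \<cdot> w = y" "x' \<cdot> w = x"
        using extendsD[OF ext _ gsubI[OF g(2,1,3)]] by metis
      then show ?thesis using dg dom[OF xy] dom[of x' y'] by (intro bexI[of _ "(x', y')"]) auto
    qed
    then show ?R by blast
  qed
  moreover have "extends Y (S\<inverse>)" if R: ?R
  proof (rule extendsI)
    fix y x g assume "(y, x) \<in> S\<inverse>" and g: "g \<in> gsub Y"
    then have xy: "(x, y) \<in> S" by simp
    have "\<exists>(x', y') \<in> S. \<exists>s \<in> hom A (Dom A g) (Dom A x'). \<exists>w \<in> hom A (Dom A x) (Dom A x').
       y' \<cdot> s = g \<and> x' \<cdot> w = x \<and> y' \<cdot> w = y"
      using bspec[OF R xy, unfolded prod.case] gsub_gen[OF g] gsub_hom[OF g] gsub_monic[OF g] by blast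
    then obtain x' y' s w where *: "(x', y') \<in> S" "s \<in> hom A (Dom A g) (Dom A x')"
      "w \<in> hom A (Dom A x) (Dom A x')" "y' \<cdot> s = g" "x' \<cdot> w = x" "y' \<cdot> w = y"
      by blast
    then show "\<exists>y' x' s w. (y', x') \<in> S\<inverse> \<and>
     s \<in> hom A (Dom A g) (Dom A y') \<and> w \<in> hom A (Dom A y) (Dom A y') \<and>
     y' \<cdot> s = g \<and> y' \<cdot> w = y \<and> x' \<cdot> w = x"
      using dom[OF xy] dom[OF *(1)] by (intro exI[of _ y'] exI[of _ x'] exI[of _ s] exI[of _ w]) simp
  qed
  ultimately show ?thesis by blast
qed

lemma lam_dense_iff:
  "lam_dense kap lam A X Y S \<longleftrightarrow>
     S \<noteq> {} \<and> (\<forall>p \<in> S. span A X Y p) \<and> extends X S \<and> extends Y (S\<inverse>)"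
proof (cases "\<forall>p \<in> S. span A X Y p")
  case True
  show ?thesis
    unfolding lam_dense_def extends_converse_iff[OF True] extends_def[of X S] by (rule refl)
next
  case False
  then show ?thesis unfolding lam_dense_def by blast
qed

definition bf_system :: "'o \<Rightarrow> 'o \<Rightarrow> 'm rel \<Rightarrow> bool" where
  "bf_system X Y S \<longleftrightarrow> (\<forall>(x, y) \<in> S. x \<in> gsub X \<and> y \<in> gsub Y \<and> Dom A x = Dom A y) \<and>
     extends X S \<and> extends Y (S\<inverse>)"

text \<open>The greatest back-and-forth system. It plays the role of equivalence in the infinitary logic
  \<open>L_\<infinity>\<lambda>\<close>.\<close>

definition bf_equiv :: "'o \<Rightarrow> 'o \<Rightarrow> 'm rel" where
  "bf_equiv X Y = \<Union> {S. bf_system X Y S}"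

lemma bf_system_converse: "bf_system X Y S \<Longrightarrow> bf_system Y X (S\<inverse>)"
  unfolding bf_system_def by auto

lemma extends_Union: "(\<And>S. S \<in> \<S> \<Longrightarrow> extends X S) \<Longrightarrow> extends X (\<Union>\<S>)"
  unfolding extends_def by fast

lemma bf_system_bf_equiv: "bf_system X Y (bf_equiv X Y)"
proof -
  have "(bf_equiv X Y)\<inverse> = \<Union> {S\<inverse> |S. bf_system X Y S}"
    unfolding bf_equiv_def by auto
  moreover have "extends Y (\<Union> {S\<inverse> |S. bf_system X Y S})"
    by (rule extends_Union) (auto simp: bf_system_def)
  moreover have "extends X (bf_equiv X Y)"
    unfolding bf_equiv_def by (rule extends_Union) (auto simp: bf_system_def)
  ultimately show ?thesis
    unfolding bf_system_def by (auto simp: bf_equiv_def bf_system_def)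
qed

lemma bf_equivD:
  assumes "(x, y) \<in> bf_equiv X Y"
  shows "x \<in> gsub X" "y \<in> gsub Y" "Dom A x = Dom A y"
  using bf_system_bf_equiv[of X Y] assms unfolding bf_system_def by auto

lemma bf_equiv_extends: "extends X (bf_equiv X Y)"
  using bf_system_bf_equiv unfolding bf_system_def by blast

lemma bf_system_subset: "bf_system X Y S \<Longrightarrow> S \<subseteq> bf_equiv X Y"
  unfolding bf_equiv_def by blast

lemma bf_equiv_converse: "(bf_equiv X Y)\<inverse> = bf_equiv Y X"
proof -
  have "(bf_equiv X Y)\<inverse> \<subseteq> bf_equiv Y X" for X Y
    using bf_system_subset[OF bf_system_converse[OF bf_system_bf_equiv]] .
  from this[of X Y] this[of Y X] show ?thesis by auto
qed

lemma bf_equiv_sym: "(x, y) \<in> bf_equiv X Y \<Longrightarrow> (y, x) \<in> bf_equiv Y X"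
  using bf_equiv_converse by blast

text \<open>Restricting spans to generated subobjects of their apex replaces large spans by small ones.\<close>

definition restrictions :: "'m rel \<Rightarrow> 'm rel" where
  "restrictions S = {(x \<cdot> h, y \<cdot> h) |x y h. (x, y) \<in> S \<and> h \<in> gsub (Dom A x)}"

lemma spanD:
  assumes "span A X Y (x, y)"
  shows "x \<in> hom A (Dom A x) X" "y \<in> hom A (Dom A x) Y" "monic A x" "monic A y" "Dom A x = Dom A y"
  using assms monic_in_hom[of x] monic_in_hom[of y] unfolding span_def by auto

text \<open>The extended span \<open>(x', y')\<close> is cut down to a generated subobject of its apex that contains both
  the old apex and the new subobject \<open>g\<close>.\<close>

lemma extends_restrictions:
  assumes sp: "\<forall>p \<in> S. span A X Y p" and ext: "extends X S"
  shows "extends X (restrictions S)"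
proof (rule extendsI)
  fix a b g assume "(a, b) \<in> restrictions S" and g: "g \<in> gsub X"
  then obtain x y h where S: "(x, y) \<in> S" and h: "h \<in> gsub (Dom A x)" and ab: "a = x \<cdot> h" "b = y \<cdot> h"
    unfolding restrictions_def by blast
  note xy = spanD[OF bspec[OF sp S]]
  obtain x' y' s w where S': "(x', y') \<in> S" and s: "s \<in> hom A (Dom A g) (Dom A x')" "x' \<cdot> s = g"
    and w: "w \<in> hom A (Dom A x) (Dom A x')" "x' \<cdot> w = x" "y' \<cdot> w = y"
    using extendsD[OF ext S g] .
  note xy' = spanD[OF bspec[OF sp S']]
  have wh: "w \<cdot> h \<in> hom A (Dom A h) (Dom A x')" using comp_in[OF gsub_hom[OF h] w(1)] .
  obtain u m1 m2 where u: "u \<in> gsub (Dom A x')"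
    and m1: "m1 \<in> hom A (Dom A g) (Dom A u)" "u \<cdot> m1 = s"
    and m2: "m2 \<in> hom A (Dom A h) (Dom A u)" "u \<cdot> m2 = w \<cdot> h"
    using gsub_factors2[OF gsub_gen[OF g] s(1) gsub_gen[OF h] wh] by metis
  note uh = gsub_hom[OF u]
  have "(x' \<cdot> u, y' \<cdot> u) \<in> restrictions S" unfolding restrictions_def using S' u by blast
  moreover have "Dom A (x' \<cdot> u) = Dom A u" "Dom A a = Dom A h"
    using gsub_comp(2)[OF u xy'(1,3)] gsub_comp(2)[OF h xy(1,3)] ab by auto
  moreover have "(x' \<cdot> u) \<cdot> m1 = g"
    using assoc[OF m1(1) uh xy'(1)] m1(2) s(2) by simp
  moreover have "(x' \<cdot> u) \<cdot> m2 = a"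
    using assoc[OF m2(1) uh xy'(1)] assoc[OF gsub_hom[OF h] w(1) xy'(1)] m2(2) w(2) ab by simp
  moreover have "(y' \<cdot> u) \<cdot> m2 = b"
    using assoc[OF m2(1) uh xy'(2)] assoc[OF gsub_hom[OF h] w(1) xy'(2)] m2(2) w(3) ab by simp
  ultimately show "\<exists>x' y' s w. (x', y') \<in> restrictions S \<and>
     s \<in> hom A (Dom A g) (Dom A x') \<and> w \<in> hom A (Dom A a) (Dom A x') \<and>
     x' \<cdot> s = g \<and> x' \<cdot> w = a \<and> y' \<cdot> w = b"
    using m1(1) m2(1) by metis
qed

lemma bf_system_restrictions:
  assumes "lam_dense kap lam A X Y S"
  shows "bf_system X Y (restrictions S)"
proof -
  have sp: "\<forall>p\<in>S. span A X Y p" and ext: "extends X S" "extends Y (S\<inverse>)"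
    using assms unfolding lam_dense_iff by auto
  have sp': "\<forall>p\<in>S\<inverse>. span A Y X p" using sp unfolding span_def by auto
  have "(restrictions S)\<inverse> = restrictions (S\<inverse>)"
    unfolding restrictions_def using spanD(5) sp by fastforce
  then have "extends Y ((restrictions S)\<inverse>)" using extends_restrictions[OF sp' ext(2)] by simp
  moreover have "a \<in> gsub X \<and> b \<in> gsub Y \<and> Dom A a = Dom A b" if ab_in: "(a, b) \<in> restrictions S" for a b
  proof -
    obtain x y h where S: "(x, y) \<in> S" and h: "h \<in> gsub (Dom A x)" and ab: "a = x \<cdot> h" "b = y \<cdot> h"
      using ab_in unfolding restrictions_def by blast
    note xy = spanD[OF bspec[OF sp S]]
    show ?thesis using gsub_comp[OF h xy(1,3)] gsub_comp[OF h xy(2,4)] ab by simp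
  qed
  ultimately show ?thesis
    unfolding bf_system_def using extends_restrictions[OF sp ext(1)] by blast
qed

lemma lam_dense_bf_equiv:
  assumes "(x, y) \<in> bf_equiv X Y"
  shows "lam_dense kap lam A X Y (bf_equiv X Y)"
  using assms bf_system_bf_equiv[of X Y]
  unfolding lam_dense_iff bf_system_def span_def gsub_def by auto

lemma bf_equiv_restrict:
  assumes "(x, y) \<in> bf_equiv X Y" "h \<in> gsub (Dom A x)"
  shows "(x \<cdot> h, y \<cdot> h) \<in> bf_equiv X Y"
  using bf_system_subset[OF bf_system_restrictions[OF lam_dense_bf_equiv[OF assms(1)]]] assms
  unfolding restrictions_def by blast

text \<open>Starting from \<open>a \<sim> b \<sim> c\<close>, extend \<open>(a, b)\<close> to \<open>(a', b')\<close> covering \<open>g\<close>, then \<open>(b, c)\<close> to some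
  \<open>(b'', c'')\<close> covering \<open>b'\<close>. The second span may be larger than the first; continuing by enlarging
  the two alternately would not stop. Instead the second span is restricted along the inclusion
  \<open>s'\<close> of \<open>b'\<close> into \<open>b''\<close>, after which the middle legs agree.\<close>

lemma extends_relcomp: "extends X (bf_equiv X Y O bf_equiv Y Z)"
proof (rule extendsI)
  fix a c g assume "(a, c) \<in> bf_equiv X Y O bf_equiv Y Z" and g: "g \<in> gsub X"
  then obtain b where ab: "(a, b) \<in> bf_equiv X Y" and bc: "(b, c) \<in> bf_equiv Y Z" by blast
  obtain a' b' s w where ab': "(a', b') \<in> bf_equiv X Y"
    and s: "s \<in> hom A (Dom A g) (Dom A a')" "a' \<cdot> s = g"
    and w: "w \<in> hom A (Dom A a) (Dom A a')" "a' \<cdot> w = a" "b' \<cdot> w = b"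
    using extendsD[OF bf_equiv_extends ab g] .
  note b' = bf_equivD(2,3)[OF ab']
  obtain b'' c'' s' w' where bc'': "(b'', c'') \<in> bf_equiv Y Z"
    and s': "s' \<in> hom A (Dom A b') (Dom A b'')" "b'' \<cdot> s' = b'"
    and w': "w' \<in> hom A (Dom A b) (Dom A b'')" "b'' \<cdot> w' = b" "c'' \<cdot> w' = c"
    using extendsD[OF bf_equiv_extends bc b'(1)] .
  note b'' = bf_equivD[OF bc'']
  have b''h: "b'' \<in> hom A (Dom A b'') Y" and c''h: "c'' \<in> hom A (Dom A b'') Z"
    using gsub_hom b'' by metis+
  have "s' \<in> gsub (Dom A b'')" using gsub_cancel[OF b'(1) s'(1) b''h s'(2)] .
  then have "(b', c'' \<cdot> s') \<in> bf_equiv Y Z" using bf_equiv_restrict[OF bc''] s'(2) by blast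
  then have "(a', c'' \<cdot> s') \<in> bf_equiv X Y O bf_equiv Y Z" using ab' by blast
  moreover have "(c'' \<cdot> s') \<cdot> w = c"
  proof -
    have w_b: "w \<in> hom A (Dom A b) (Dom A b')" using w(1) b'(2) bf_equivD(3)[OF ab] by simp
    have "b'' \<cdot> (s' \<cdot> w) = b'' \<cdot> w'"
      using assoc[OF w_b s'(1) b''h] s'(2) w(3) w'(2) by simp
    then have "s' \<cdot> w = w'"
      using monicD[OF gsub_monic[OF b''(1)] b''h comp_in[OF w_b s'(1)] w'(1)] by blast
    then show ?thesis using assoc[OF w_b s'(1) c''h] w'(3) by simp
  qed
  ultimately show "\<exists>x' y' s w. (x', y') \<in> bf_equiv X Y O bf_equiv Y Z \<and>
     s \<in> hom A (Dom A g) (Dom A x') \<and> w \<in> hom A (Dom A a) (Dom A x') \<and>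
     x' \<cdot> s = g \<and> x' \<cdot> w = a \<and> y' \<cdot> w = c"
    using s w by blast
qed

lemma bf_equiv_trans:
  assumes "(a, b) \<in> bf_equiv X Y" "(b, c) \<in> bf_equiv Y Z"
  shows "(a, c) \<in> bf_equiv X Z"
proof -
  have "(bf_equiv X Y O bf_equiv Y Z)\<inverse> = bf_equiv Z Y O bf_equiv Y X"
    by (simp add: converse_relcomp bf_equiv_converse)
  then have "extends Z ((bf_equiv X Y O bf_equiv Y Z)\<inverse>)"
    using extends_relcomp by simp
  moreover have "x \<in> gsub X \<and> z \<in> gsub Z \<and> Dom A x = Dom A z"
    if "(x, z) \<in> bf_equiv X Y O bf_equiv Y Z" for x z
  proof -
    obtain y where "(x, y) \<in> bf_equiv X Y" "(y, z) \<in> bf_equiv Y Z"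
      using \<open>(x, z) \<in> _\<close> by blast
    from bf_equivD[OF this(1)] bf_equivD[OF this(2)] show ?thesis by simp
  qed
  ultimately have "bf_system X Z (bf_equiv X Y O bf_equiv Y Z)"
    unfolding bf_system_def using extends_relcomp by blast
  then show ?thesis using bf_system_subset assms by blast
qed


section \<open>Embeddings\<close>

text \<open>An embedding preserves and reflects the type of every small tuple. The span witnessing the
  embedding at \<open>g\<close>, restricted along the factorisation \<open>t\<close> of \<open>g\<close> through it, is \<open>(g, f g)\<close>.\<close>

lemma lam_embeddingD:
  assumes "lam_embedding kap lam A f" and f: "f \<in> hom A X Y" and g: "g \<in> gsub X"
  shows "(g, f \<cdot> g) \<in> bf_equiv X Y"
proof -
  have "Dom A f = X" "Cod A f = Y" using f by (auto simp: hom_def)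
  then obtain S u v t where S: "lam_dense kap lam A X Y S" and uv: "(u, v) \<in> S"
    and t: "t \<in> hom A (Dom A g) (Dom A u)" "u \<cdot> t = g" "v \<cdot> t = f \<cdot> g"
    using assms(1) gsub_gen[OF g] gsub_hom[OF g] gsub_monic[OF g]
    unfolding lam_embedding_def by fast
  have "span A X Y (u, v)" using S uv unfolding lam_dense_def by blast
  then have "t \<in> gsub (Dom A u)" using gsub_cancel[OF g t(1)] spanD(1) t(2) by blast
  then have "(g, f \<cdot> g) \<in> restrictions S"
    unfolding restrictions_def using uv t(2,3) by force
  then show ?thesis using bf_system_subset[OF bf_system_restrictions[OF S]] by blast
qed

lemma lam_embeddingI:
  assumes f: "f \<in> hom A X Y" and eq: "\<And>g. g \<in> gsub X \<Longrightarrow> (g, f \<cdot> g) \<in> bf_equiv X Y"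
  shows "lam_embedding kap lam A f"
proof -
  obtain g0 where "g0 \<in> gsub X" using gsub_nonempty hom_obj[OF f] by blast
  then have dense: "lam_dense kap lam A X Y (bf_equiv X Y)"
    using lam_dense_bf_equiv eq by blast
  have "\<exists>(u, v) \<in> bf_equiv X Y. \<exists>t \<in> hom A G (Dom A u). u \<cdot> t = g \<and> v \<cdot> t = f \<cdot> g"
    if "gen G" "g \<in> hom A G X" "monic A g" for G g
  proof -
    have "Dom A g = G" "G \<in> Obj A" using that(2) hom_obj by (auto simp: hom_def)
    then show ?thesis
      using eq[OF gsubI[OF that(2,1,3)]] idt_in comp_idt[OF that(2)] comp_idt[OF comp_in[OF that(2) f]]
      by fastforce
  qed
  then show ?thesis
    unfolding lam_embedding_def using dense homD[OF f] by auto
qed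

text \<open>On a generated subobject \<open>g\<close> the composite \<open>f g\<close> is monic, being equivalent to \<open>g\<close>, and any two
  arrows from a generated object factor through a common \<open>g\<close>.\<close>

lemma lam_embedding_monic:
  assumes emb: "lam_embedding kap lam A f"
  shows "monic A f"
proof -
  have f: "f \<in> hom A (Dom A f) (Cod A f)"
    using emb arr_in_hom unfolding lam_embedding_def by blast
  show ?thesis
  proof (rule monicI_generated[OF f])
    fix G p q assume G: "gen G" and p: "p \<in> hom A G (Dom A f)" and q: "q \<in> hom A G (Dom A f)"
      and eq: "f \<cdot> p = f \<cdot> q"
    obtain g p' q' where g: "g \<in> gsub (Dom A f)" and p': "p' \<in> hom A G (Dom A g)" "g \<cdot> p' = p"
      and q': "q' \<in> hom A G (Dom A g)" "g \<cdot> q' = q"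
      using gsub_factors2[OF G p G q] by metis
    have "monic A (f \<cdot> g)"
      using gsub_monic[OF bf_equivD(2)[OF lam_embeddingD[OF emb f g]]] .
    moreover have "(f \<cdot> g) \<cdot> p' = (f \<cdot> g) \<cdot> q'"
      using assoc[OF p'(1) gsub_hom[OF g] f] assoc[OF q'(1) gsub_hom[OF g] f] p'(2) q'(2) eq by simp
    ultimately have "p' = q'"
      using monicD[OF _ comp_in[OF gsub_hom[OF g] f] p'(1) q'(1)] by blast
    then show "p = q" using p' q' by simp
  qed
qed

lemma gsub_factors_above:
  fixes r :: "'i rel"
  assumes r: "|Field r| <o kap" "directed_poset lam r" "mono_diagram r A F" "colimit r A F C k"
    and d: "d \<in> Field r" and g: "g \<in> gsub C"
  obtains e g' where "(d, e) \<in> r" "g' \<in> gsub (ob F e)" "g = k e \<cdot> g'" "Dom A g' = Dom A g"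
proof -
  obtain d' h where h: "d' \<in> Field r" "h \<in> hom A (Dom A g) (ob F d')" "g = k d' \<cdot> h"
    using generated_factors[OF r gsub_gen[OF g] gsub_hom[OF g]] by blast
  obtain e where e: "(d, e) \<in> r" "(d', e) \<in> r" using directed_poset_ub2[OF Cinf r(2) d h(1)] .
  have ke: "k e \<in> hom A (ob F e) C" using colimitD(2)[OF r(4)] e by (auto simp: Field_def)
  have ar: "ar F d' e \<in> hom A (ob F d') (ob F e)"
    using r(3) e unfolding mono_diagram_def poset_functor_def by blast
  have h': "ar F d' e \<cdot> h \<in> hom A (Dom A g) (ob F e)" using comp_in[OF h(2) ar] .
  have eq: "k e \<cdot> (ar F d' e \<cdot> h) = g"
    using assoc[OF h(2) ar ke] colimitD(3)[OF r(4) e(2)] h(3) by simp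
  show ?thesis
    using that[OF e(1) gsub_cancel[OF g h' ke eq] eq[symmetric]] homD[OF h'] by blast
qed

text \<open>The analogue of Tarski's union theorem for elementary chains. The system between a stage \<open>d\<close> and
  the colimit consists of the pairs \<open>(a, k e b)\<close> with \<open>a\<close> at stage \<open>d\<close> equivalent to \<open>b\<close> at some later
  stage \<open>e\<close>. Going back happens at the same stage. Going forth from a new subobject of the colimit
  requires moving to a stage \<open>e'\<close> where that subobject lives, and this preserves equivalence with
  \<open>a\<close> because the transition map from \<open>e\<close> to \<open>e'\<close> is an embedding.\<close>

lemma colimit_injection_embedding:
  fixes r :: "'i rel"
  assumes small: "|Field r| <o kap" and dir: "directed_poset lam r" and F: "poset_functor r A F"
    and emb: "\<And>d e. (d, e) \<in> r \<Longrightarrow> lam_embedding kap lam A (ar F d e)"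
    and col: "colimit r A F C k" and d: "d \<in> Field r"
  shows "lam_embedding kap lam A (k d)"
proof (rule lam_embeddingI[OF colimitD(2)[OF col d]])
  have md: "mono_diagram r A F" unfolding mono_diagram_def using F emb lam_embedding_monic by blast
  note r = small dir md col
  have Fhom: "\<And>d e. (d, e) \<in> r \<Longrightarrow> ar F d e \<in> hom A (ob F d) (ob F e)"
    using F unfolding poset_functor_def by blast
  have k: "k e \<in> hom A (ob F e) C" "monic A (k e)" if "(d, e) \<in> r" for d e
    using colimitD(2)[OF col] colimit_injection_monic[OF r] that by (auto simp: Field_def)
  define S where "S = {(a, k e \<cdot> b) |a b e. (d, e) \<in> r \<and> (a, b) \<in> bf_equiv (ob F d) (ob F e)}"
  have sub: "a \<in> gsub (ob F d) \<and> c \<in> gsub C \<and> Dom A a = Dom A c" if "(a, c) \<in> S" for a c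
  proof -
    obtain b e where e: "(d, e) \<in> r" and ab: "(a, b) \<in> bf_equiv (ob F d) (ob F e)" and c: "c = k e \<cdot> b"
      using \<open>(a, c) \<in> S\<close> unfolding S_def by blast
    show ?thesis using bf_equivD[OF ab] gsub_comp[OF _ k[OF e]] c by auto
  qed
  have back_ext: "extends (ob F d) S"
  proof (rule extendsI)
    fix a c g assume "(a, c) \<in> S" and g: "g \<in> gsub (ob F d)"
    then obtain b e where e: "(d, e) \<in> r" and ab: "(a, b) \<in> bf_equiv (ob F d) (ob F e)"
      and c: "c = k e \<cdot> b"
      unfolding S_def by blast
    obtain a' b' s w where ab': "(a', b') \<in> bf_equiv (ob F d) (ob F e)"
      and s: "s \<in> hom A (Dom A g) (Dom A a')" "a' \<cdot> s = g"
      and w: "w \<in> hom A (Dom A a) (Dom A a')" "a' \<cdot> w = a" "b' \<cdot> w = b"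
      using extendsD[OF bf_equiv_extends ab g] .
    have "b' \<in> hom A (Dom A a') (ob F e)" using gsub_hom bf_equivD(2,3)[OF ab'] by metis
    then have "(k e \<cdot> b') \<cdot> w = c" using assoc[OF w(1) _ k(1)[OF e]] w(3) c by simp
    moreover have "(a', k e \<cdot> b') \<in> S" unfolding S_def using e ab' by blast
    ultimately show "\<exists>x' y' s w. (x', y') \<in> S \<and>
     s \<in> hom A (Dom A g) (Dom A x') \<and> w \<in> hom A (Dom A a) (Dom A x') \<and>
     x' \<cdot> s = g \<and> x' \<cdot> w = a \<and> y' \<cdot> w = c"
      using s w by blast
  qed
  have forth_ext: "extends C (S\<inverse>)"
  proof (rule extendsI)
    fix c a g assume "(c, a) \<in> S\<inverse>" and g: "g \<in> gsub C"
    then obtain b e where e: "(d, e) \<in> r" and ab: "(a, b) \<in> bf_equiv (ob F d) (ob F e)"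
      and c: "c = k e \<cdot> b"
      unfolding S_def by blast
    then have "e \<in> Field r" by (auto simp: Field_def)
    then obtain e' g' where e': "(e, e') \<in> r" and g': "g' \<in> gsub (ob F e')" "g = k e' \<cdot> g'"
      "Dom A g' = Dom A g"
      using gsub_factors_above[OF r _ g] by blast
    have de': "(d, e') \<in> r" using directed_poset_trans[OF dir e e'] .
    note b = bf_equivD(2,3)[OF ab]
    have "(b, ar F e e' \<cdot> b) \<in> bf_equiv (ob F e) (ob F e')"
      using lam_embeddingD[OF emb Fhom b(1)] e' by blast
    then have *: "(ar F e e' \<cdot> b, a) \<in> bf_equiv (ob F e') (ob F d)"
      using bf_equiv_sym bf_equiv_trans[OF ab] by blast
    have dom: "Dom A (ar F e e' \<cdot> b) = Dom A c"
      using homD[OF comp_in[OF gsub_hom[OF b(1)] Fhom[OF e']]]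
        homD[OF comp_in[OF gsub_hom[OF b(1)] k(1)[OF e]]] c by simp
    obtain b' a' s w where ba': "(b', a') \<in> bf_equiv (ob F e') (ob F d)"
      and s: "s \<in> hom A (Dom A g') (Dom A b')" "b' \<cdot> s = g'"
      and w: "w \<in> hom A (Dom A (ar F e e' \<cdot> b)) (Dom A b')" "b' \<cdot> w = ar F e e' \<cdot> b" "a' \<cdot> w = a"
      using extendsD[OF bf_equiv_extends * g'(1)] .
    note b' = bf_equivD(1)[OF ba']
    have dom': "Dom A (k e' \<cdot> b') = Dom A b'" using gsub_comp(2)[OF b' k[OF de']] .
    have "(k e' \<cdot> b', a') \<in> S\<inverse>"
      unfolding S_def using de' bf_equiv_sym[OF ba'] by blast
    moreover have "(k e' \<cdot> b') \<cdot> s = g"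
      using assoc[OF s(1) gsub_hom[OF b'] k(1)[OF de']] s(2) g'(2) by simp
    moreover have "(k e' \<cdot> b') \<cdot> w = c"
      using assoc[OF w(1) gsub_hom[OF b'] k(1)[OF de']] w(2)
        assoc[OF gsub_hom[OF b(1)] Fhom[OF e'] k(1)[OF de']] colimitD(3)[OF col e'] c by simp
    ultimately show "\<exists>x' y' s w. (x', y') \<in> S\<inverse> \<and>
     s \<in> hom A (Dom A g) (Dom A x') \<and> w \<in> hom A (Dom A c) (Dom A x') \<and>
     x' \<cdot> s = g \<and> x' \<cdot> w = c \<and> y' \<cdot> w = a"
      using s(1) w(1,3) dom dom' g'(3) by metis
  qed
  have bf: "bf_system (ob F d) C S"
    unfolding bf_system_def using sub back_ext forth_ext by blast
  fix g assume g: "g \<in> gsub (ob F d)"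
  have dd: "(d, d) \<in> r" using directed_poset_refl[OF dir d] .
  \<comment> \<open>The identity transition map at \<open>d\<close> is an embedding, which gives reflexivity of the equivalence.\<close>
  have "(g, ar F d d \<cdot> g) \<in> bf_equiv (ob F d) (ob F d)"
    using lam_embeddingD[OF emb[OF dd] Fhom[OF dd] g] .
  moreover have "k d \<cdot> (ar F d d \<cdot> g) = k d \<cdot> g"
    using assoc[OF gsub_hom[OF g] Fhom[OF dd] k(1)[OF dd]] colimitD(3)[OF col dd] by simp
  ultimately have "(g, k d \<cdot> g) \<in> S"
    unfolding S_def using dd by (intro CollectI exI[of _ g] exI[of _ "ar F d d \<cdot> g"] exI[of _ d]) simp
  then show "(g, k d \<cdot> g) \<in> bf_equiv (ob F d) C" using bf_system_subset[OF bf] by blast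
qed

end

context cat
begin

lemma induced_arrow_colimit:
  assumes F1: "poset_functor r A F1" and F2: "poset_functor r A F2"
    and col1: "colimit r A F1 C1 k1" and col2: "colimit r A F2 C2 k2"
    and nat: "natural_transformation r A F1 F2 \<eta>"
  shows "induced_arrow r A C1 k1 C2 k2 \<eta> \<in> hom A C1 C2"
    and "\<And>d. d \<in> Field r \<Longrightarrow> induced_arrow r A C1 k1 C2 k2 \<eta> \<cdot> k1 d = k2 d \<cdot> \<eta> d"
proof -
  note k2 = colimitD[OF col2]
  have \<eta>: "\<And>d. d \<in> Field r \<Longrightarrow> \<eta> d \<in> hom A (ob F1 d) (ob F2 d)"
    and \<eta>_nat: "\<And>d e. (d, e) \<in> r \<Longrightarrow> \<eta> e \<cdot> ar F1 d e = ar F2 d e \<cdot> \<eta> d"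
    using nat unfolding natural_transformation_def by auto
  have F1h: "\<And>d e. (d, e) \<in> r \<Longrightarrow> ar F1 d e \<in> hom A (ob F1 d) (ob F1 e)"
    and F2h: "\<And>d e. (d, e) \<in> r \<Longrightarrow> ar F2 d e \<in> hom A (ob F2 d) (ob F2 e)"
    using F1 F2 unfolding poset_functor_def by auto
  have "cocone r A F1 C2 (\<lambda>d. k2 d \<cdot> \<eta> d)"
    unfolding cocone_def
  proof (intro conjI allI ballI impI)
    show "C2 \<in> Obj A" using k2(1) .
    show "k2 d \<cdot> \<eta> d \<in> hom A (ob F1 d) C2" if "d \<in> Field r" for d
      using comp_in \<eta> k2(2) that by blast
    show "(k2 e \<cdot> \<eta> e) \<cdot> ar F1 d e = k2 d \<cdot> \<eta> d" if de: "(d, e) \<in> r" for d e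
    proof -
      have d: "d \<in> Field r" and e: "e \<in> Field r" using de by (auto simp: Field_def)
      have "(k2 e \<cdot> \<eta> e) \<cdot> ar F1 d e = k2 e \<cdot> (ar F2 d e \<cdot> \<eta> d)"
        using assoc[OF F1h[OF de] \<eta>[OF e] k2(2)[OF e]] \<eta>_nat[OF de] by simp
      also have "\<dots> = k2 d \<cdot> \<eta> d"
        using assoc[OF \<eta>[OF d] F2h[OF de] k2(2)[OF e]] k2(3)[OF de] by simp
      finally show ?thesis .
    qed
  qed
  then have "\<exists>!h. h \<in> hom A C1 C2 \<and> (\<forall>d\<in>Field r. h \<cdot> k1 d = k2 d \<cdot> \<eta> d)"
    using col1 unfolding colimit_def by blast
  from theI'[OF this, folded induced_arrow_def]
  show "induced_arrow r A C1 k1 C2 k2 \<eta> \<in> hom A C1 C2"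
    and "\<And>d. d \<in> Field r \<Longrightarrow> induced_arrow r A C1 k1 C2 k2 \<eta> \<cdot> k1 d = k2 d \<cdot> \<eta> d"
    by auto
qed

end

theorem theorem4p2:
  fixes kap :: "'i rel" and lam :: "'k rel"
    and A :: "('o, 'm) category"
    and r :: "'i rel"
    and F1 F2 :: "('i, 'o, 'm) diagram"
    and C1 C2 :: 'o and k1 k2 \<eta> :: "'i \<Rightarrow> 'm"
  assumes "Card_order kap"
    and "Cinfinite lam" and "regularCard lam"
    and "category A" and "lam_mono_generated kap lam A"
    and "|Field r| <o kap" and "directed_poset lam r"
    and "poset_functor r A F1" and "\<And>d e. (d, e) \<in> r \<Longrightarrow> lam_embedding kap lam A (ar F1 d e)"
    and "poset_functor r A F2" and "\<And>d e. (d, e) \<in> r \<Longrightarrow> lam_embedding kap lam A (ar F2 d e)"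
    and "colimit r A F1 C1 k1" and "colimit r A F2 C2 k2"
    and "natural_transformation r A F1 F2 \<eta>"
    and "\<And>d. d \<in> Field r \<Longrightarrow> lam_embedding kap lam A (\<eta> d)"
  shows "lam_embedding kap lam A (induced_arrow r A C1 k1 C2 k2 \<eta>)"
proof -
  interpret mono_generated_cat A kap lam
    using assms(2,4,5) by unfold_locales
  let ?f = "induced_arrow r A C1 k1 C2 k2 \<eta>"
  note f = induced_arrow_colimit[OF assms(8,10,12,13,14)]
  show ?thesis
  proof (rule lam_embeddingI[OF f(1)])
    fix g assume g: "g \<in> gsub C1"
    have md1: "mono_diagram r A F1"
      unfolding mono_diagram_def using assms(8,9) lam_embedding_monic by blast
    obtain d0 where "d0 \<in> Field r" using directed_poset_nonempty[OF assms(2,7)] .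
    then obtain d g' where "(d0, d) \<in> r" and g': "g' \<in> gsub (ob F1 d)" and gg': "g = k1 d \<cdot>\<^bsub>A\<^esub> g'"
      using gsub_factors_above[OF assms(6,7) md1 assms(12) _ g] by metis
    then have d: "d \<in> Field r" by (auto simp: Field_def)
    note k1 = colimitD(2)[OF assms(12) d] and k2 = colimitD(2)[OF assms(13) d]
    have \<eta>: "\<eta> d \<in> hom A (ob F1 d) (ob F2 d)"
      using assms(14) d unfolding natural_transformation_def by blast
    have 1: "(g', g) \<in> bf_equiv (ob F1 d) C1"
      using lam_embeddingD[OF colimit_injection_embedding[OF assms(6-9,12) d] k1 g'] gg' by simp
    have 2: "(g', \<eta> d \<cdot>\<^bsub>A\<^esub> g') \<in> bf_equiv (ob F1 d) (ob F2 d)"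
      using lam_embeddingD[OF assms(15)[OF d] \<eta> g'] .
    have 3: "(\<eta> d \<cdot>\<^bsub>A\<^esub> g', k2 d \<cdot>\<^bsub>A\<^esub> (\<eta> d \<cdot>\<^bsub>A\<^esub> g')) \<in> bf_equiv (ob F2 d) C2"
      using lam_embeddingD[OF colimit_injection_embedding[OF assms(6,7,10,11,13) d] k2 bf_equivD(2)[OF 2]] .
    have "k2 d \<cdot>\<^bsub>A\<^esub> (\<eta> d \<cdot>\<^bsub>A\<^esub> g') = ?f \<cdot>\<^bsub>A\<^esub> g"
      using assoc[OF gsub_hom[OF g'] \<eta> k2] assoc[OF gsub_hom[OF g'] k1 f(1)] f(2)[OF d] gg' by simp
    then show "(g, ?f \<cdot>\<^bsub>A\<^esub> g) \<in> bf_equiv C1 C2"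
      using bf_equiv_trans[OF bf_equiv_trans[OF bf_equiv_sym[OF 1] 2] 3] by simp
  qed
qed

end
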